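(* Let $X$ be a Helly graph, and assume that a bi-infinite sequence of cliques $(\sigma_n)_{n\in\mathbb{Z}}$ in $X$ is such that for all $n\in\mathbb{Z}$, the sequence $(\sigma_n,\sigma_{n+1},\sigma_{n+2})$ is a clique-path. Then, for any $n,m\in\mathbb{Z}$, we have $d(\sigma_n,\sigma_m)\ge |n-m|$.
   Context: A connected graph $X$ (identified with its vertex set with graph metric $d$) is Helly if any family of pairwise intersecting combinatorial balls has non-empty global intersection. A clique is a non-empty set of pairwise adjacent vertices (not necessarily maximal). For cliques $\sigma,\tau$, $d(\sigma,\tau)=\min\{d(x,y): x\in\sigma,y\in\tau\}$. Two cliques $\sigma,\tau$ are at transverse distance $n\ge 0$, denoted $\sigma\lessgtr\tau=n$, if: (i) for every $x\in\sigma$, $y\in\tau$ we have $d(x,y)\ge n$; (ii) there exists $x\in\sigma$ such that $d(x,y)=n$ for all $y\in\tau$; (iii) there exists $y\in\tau$ such that $d(x,y)=n$ for all $x\in\sigma$. For an integer $L\ge1$, a sequence of pairwise disjoint cliques $\sigma_0,\dots,\sigma_n$ is an $L$-clique-path if: for every $0\le i<j\le n$, $\sigma_i\lessgtr\sigma_j=(j-i)L$; and for every $1\le i\le n-1$, $\sigma_i$ is maximal (for inclusion) among the cliques $\sigma$ satisfying $\sigma\lessgtr\sigma_{i+1}=L$ and $\sigma\lessgtr\sigma_{i-1}=L$. A clique-path is a $1$-clique-path. *)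

theory Defs
  imports Complex_Main
begin

locale connected_graph =
  fixes V :: "'a set" and E :: "('a \<times> 'a) set"
  assumes nonempty: "V \<noteq> {}"
    and edges_in_verts: "E \<subseteq> V \<times> V"
    and sym_edges: "sym E"
    and irrefl_edges: "irrefl E"
    and connected: "\<And>x y. x \<in> V \<Longrightarrow> y \<in> V \<Longrightarrow> (x, y) \<in> E\<^sup>*"

(* (x, y) \<in> E ^^ n means that there is a walk with n edges from x to y. *)
definition graph_dist :: "('a \<times> 'a) set \<Rightarrow> 'a \<Rightarrow> 'a \<Rightarrow> nat" where
  "graph_dist E x y = (LEAST n. (x, y) \<in> E ^^ n)"

definition graph_ball :: "'a set \<Rightarrow> ('a \<times> 'a) set \<Rightarrow> 'a \<Rightarrow> nat \<Rightarrow> 'a set" where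
  "graph_ball V E x r = {y \<in> V. graph_dist E x y \<le> r}"

(* Families of balls are arbitrary, in particular possibly infinite. *)
locale helly_graph = connected_graph V E for V :: "'a set" and E :: "('a \<times> 'a) set" +
  assumes helly:
    "\<And>\<B>. \<B> \<subseteq> {graph_ball V E x r | x r. x \<in> V} \<Longrightarrow>
      (\<And>A B. A \<in> \<B> \<Longrightarrow> B \<in> \<B> \<Longrightarrow> A \<inter> B \<noteq> {}) \<Longrightarrow> V \<inter> \<Inter>\<B> \<noteq> {}"

definition clique :: "'a set \<Rightarrow> ('a \<times> 'a) set \<Rightarrow> 'a set \<Rightarrow> bool" where
  "clique V E \<sigma> \<longleftrightarrow> \<sigma> \<noteq> {} \<and> \<sigma> \<subseteq> V \<and> (\<forall>x\<in>\<sigma>. \<forall>y\<in>\<sigma>. x \<noteq> y \<longrightarrow> (x, y) \<in> E)"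

(* Cliques may be infinite, which rules out Min; on non-empty sets of naturals Inf is attained. *)
definition clique_dist :: "('a \<times> 'a) set \<Rightarrow> 'a set \<Rightarrow> 'a set \<Rightarrow> nat" where
  "clique_dist E \<sigma> \<tau> = Inf {graph_dist E x y | x y. x \<in> \<sigma> \<and> y \<in> \<tau>}"

definition transverse_dist :: "('a \<times> 'a) set \<Rightarrow> 'a set \<Rightarrow> 'a set \<Rightarrow> nat \<Rightarrow> bool" where
  "transverse_dist E \<sigma> \<tau> n \<longleftrightarrow>
     (\<forall>x\<in>\<sigma>. \<forall>y\<in>\<tau>. n \<le> graph_dist E x y) \<and>
     (\<exists>x\<in>\<sigma>. \<forall>y\<in>\<tau>. graph_dist E x y = n) \<and>
     (\<exists>y\<in>\<tau>. \<forall>x\<in>\<sigma>. graph_dist E x y = n)"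

(* The finite sequence \<sigma>_0, ..., \<sigma>_n is the list \<sigma>s of length n + 1. *)
definition L_clique_path ::
    "'a set \<Rightarrow> ('a \<times> 'a) set \<Rightarrow> nat \<Rightarrow> 'a set list \<Rightarrow> bool" where
  "L_clique_path V E L \<sigma>s \<longleftrightarrow>
     1 \<le> L \<and> \<sigma>s \<noteq> [] \<and>
     (\<forall>\<sigma>\<in>set \<sigma>s. clique V E \<sigma>) \<and>
     (\<forall>i j. i < j \<and> j < length \<sigma>s \<longrightarrow> \<sigma>s ! i \<inter> \<sigma>s ! j = {}) \<and>
     (\<forall>i j. i < j \<and> j < length \<sigma>s \<longrightarrow> transverse_dist E (\<sigma>s ! i) (\<sigma>s ! j) ((j - i) * L)) \<and>
     (\<forall>i. 1 \<le> i \<and> i + 1 < length \<sigma>s \<longrightarrow>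
        (\<forall>\<sigma>. clique V E \<sigma> \<and> transverse_dist E \<sigma> (\<sigma>s ! (i + 1)) L \<and>
             transverse_dist E \<sigma> (\<sigma>s ! (i - 1)) L \<and> \<sigma>s ! i \<subseteq> \<sigma> \<longrightarrow> \<sigma> = \<sigma>s ! i))"

abbreviation clique_path :: "'a set \<Rightarrow> ('a \<times> 'a) set \<Rightarrow> 'a set list \<Rightarrow> bool" where
  "clique_path V E \<sigma>s \<equiv> L_clique_path V E 1 \<sigma>s"

end

theory Submission
  imports Defs
begin

text \<open>
  The proof is an induction on \<open>n\<close>, showing that any two vertices of \<open>\<sigma> i\<close> and \<open>\<sigma> (i + n)\<close> are at
  distance at least \<open>n\<close>. The hypotheses give the cases \<open>n \<le> 2\<close>; write \<open>d\<close> for the graph distance.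

  The Helly property and maximality are used together, in \<open>helly_point_in_middle\<close>. Let
  \<open>A\<close>, \<open>B\<close>, \<open>C\<close> be three consecutive cliques. A vertex that is within distance \<open>1\<close> of all of \<open>B\<close>, of
  a vertex of \<open>A\<close> adjacent to all of \<open>B\<close>, and of a vertex of \<open>C\<close> adjacent to all of \<open>B\<close>, could be
  added to \<open>B\<close>, so it lies in \<open>B\<close>. Hence a common point of the corresponding unit balls and of a
  ball of radius \<open>k\<close> about some vertex \<open>p\<close> is a point of \<open>B\<close> within distance \<open>k\<close> of \<open>p\<close>, and the
  Helly property provides it as soon as the centres of the unit balls are within \<open>k + 1\<close> of \<open>p\<close>.

  Suppose now that \<open>n \<ge> 3\<close> and that \<open>p \<in> \<sigma> i\<close>, \<open>q \<in> \<sigma> (i + n)\<close> satisfy \<open>d p q \<le> n - 1\<close>. Three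
  applications of the lemma give a contradiction. With middle clique \<open>\<sigma> (i + n)\<close> it replaces \<open>q\<close> by
  some \<open>z \<in> \<sigma> (i + n)\<close> adjacent to all of \<open>\<sigma> (i + n - 1)\<close>. With middle clique \<open>\<sigma> i\<close>, it replaces
  \<open>p\<close> by some \<open>x \<in> \<sigma> i\<close> adjacent to all of \<open>\<sigma> (i + 1)\<close>. Both replacements
  (\<open>move_towards_neighbour\<close>) preserve the bound \<open>n - 1\<close>. Since \<open>x\<close> starts a
  path of the expected length to every vertex of every later clique, the lemma with middle clique
  \<open>\<sigma> (i + n - 1)\<close> finally yields a vertex of that clique within \<open>n - 2\<close> of \<open>x\<close>, contrary to the
  induction hypothesis.

  The first two applications look at the cliques beyond the ends, \<open>\<sigma> (i + n + 1)\<close> and \<open>\<sigma> (i - 1)\<close>;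
  this is where it matters that the sequence is infinite in both directions. For finite sequences,
  whose end cliques need not be maximal, the bound can fail.
\<close>

section \<open>Distances and balls in a connected graph\<close>

context connected_graph
begin

abbreviation d :: "'a \<Rightarrow> 'a \<Rightarrow> nat" where
  "d \<equiv> graph_dist E"

lemma dist_le_walk: "(x, y) \<in> E ^^ n \<Longrightarrow> d x y \<le> n"
  unfolding graph_dist_def by (rule Least_le)

lemma dist_walk:
  assumes "x \<in> V" "y \<in> V"
  shows "(x, y) \<in> E ^^ d x y"
proof -
  obtain n where "(x, y) \<in> E ^^ n"
    using connected[OF assms] rtrancl_power by blast
  then show ?thesis unfolding graph_dist_def by (rule LeastI)
qed

lemma walk_in_verts: "(x, y) \<in> E ^^ n \<Longrightarrow> x \<in> V \<Longrightarrow> y \<in> V"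
  using edges_in_verts by (cases n) auto

lemma walk_sym: "(x, y) \<in> E ^^ n \<Longrightarrow> (y, x) \<in> E ^^ n"
proof (induction n arbitrary: y)
  case (Suc n)
  then obtain u where u: "(x, u) \<in> E ^^ n" "(u, y) \<in> E" by auto
  then have "(y, u) \<in> E" using sym_edges by (meson symD)
  with Suc.IH[OF u(1)] show ?case by (meson relpow_Suc_I2)
qed simp

lemma dist_sym: "x \<in> V \<Longrightarrow> y \<in> V \<Longrightarrow> d x y = d y x"
  by (meson dist_le_walk dist_walk walk_sym le_antisym)

lemma dist_triangle:
  assumes "x \<in> V" "y \<in> V" "z \<in> V"
  shows "d x z \<le> d x y + d y z"
proof (rule dist_le_walk)
  show "(x, z) \<in> E ^^ (d x y + d y z)"
    unfolding relpow_add using dist_walk assms by blast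
qed

lemma dist_self [simp]: "d x x = 0"
  using dist_le_walk[of x x 0] by simp

lemma dist_eq_0: "x \<in> V \<Longrightarrow> y \<in> V \<Longrightarrow> d x y = 0 \<Longrightarrow> x = y"
  using dist_walk[of x y] by simp

lemma dist_edge: "(x, y) \<in> E \<Longrightarrow> d x y \<le> 1"
  using dist_le_walk[of x y 1] by simp

lemma edge_if_dist_le_1:
  assumes "x \<in> V" "y \<in> V" "d x y \<le> 1" "x \<noteq> y"
  shows "(x, y) \<in> E"
proof -
  have "d x y = 1" using assms dist_eq_0[of x y] by linarith
  then show ?thesis using dist_walk[of x y] assms by simp
qed

lemma balls_meet:
  assumes "x \<in> V" "y \<in> V" "d x y \<le> r + s"
  shows "graph_ball V E x r \<inter> graph_ball V E y s \<noteq> {}"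
proof -
  define k where "k = min r (d x y)"
  have split: "d x y = k + (d x y - k)" by (simp add: k_def)
  have "(x, y) \<in> E ^^ k O E ^^ (d x y - k)"
    using dist_walk[OF assms(1,2)] split relpow_add by metis
  then obtain u where u: "(x, u) \<in> E ^^ k" "(u, y) \<in> E ^^ (d x y - k)"
    by blast
  have uV: "u \<in> V" using walk_in_verts[OF u(1) assms(1)] .
  have "d x u \<le> r" using dist_le_walk[OF u(1)] by (simp add: k_def)
  moreover have "d y u \<le> s"
    using dist_le_walk[OF walk_sym[OF u(2)]] assms(3) by (auto simp: k_def min_def split: if_splits)
  ultimately show ?thesis using uV by (auto simp: graph_ball_def)
qed

lemma clique_dist_le_1: "clique V E \<tau> \<Longrightarrow> x \<in> \<tau> \<Longrightarrow> y \<in> \<tau> \<Longrightarrow> d x y \<le> 1"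
  unfolding clique_def using dist_edge by (cases "x = y") auto

lemma clique_verts: "clique V E \<tau> \<Longrightarrow> x \<in> \<tau> \<Longrightarrow> x \<in> V"
  unfolding clique_def by blast

lemma transverse_dist_sym:
  assumes "A \<subseteq> V" "B \<subseteq> V" "transverse_dist E A B n"
  shows "transverse_dist E B A n"
proof -
  have "d x y = d y x" if "x \<in> A" "y \<in> B" for x y
    using that assms dist_sym by blast
  with assms(3) show ?thesis unfolding transverse_dist_def by metis
qed

section \<open>Three consecutive cliques\<close>

text \<open>
  A clique-path with three members, in a form that is visibly invariant under reversal. Of the
  transverse distance \<open>2\<close> between the outer cliques only the lower bound is recorded: the upper
  bounds follow by passing through \<open>B\<close>.
\<close>

definition clique_triple :: "'a set \<Rightarrow> 'a set \<Rightarrow> 'a set \<Rightarrow> bool" where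
  "clique_triple A B C \<longleftrightarrow>
     clique V E A \<and> clique V E B \<and> clique V E C \<and>
     transverse_dist E B A 1 \<and> transverse_dist E B C 1 \<and>
     (\<forall>a\<in>A. \<forall>c\<in>C. 2 \<le> d a c) \<and>
     (\<forall>\<tau>. clique V E \<tau> \<and> transverse_dist E \<tau> A 1 \<and> transverse_dist E \<tau> C 1 \<and> B \<subseteq> \<tau> \<longrightarrow> \<tau> = B)"

lemma clique_triple_rev:
  assumes "clique_triple A B C"
  shows "clique_triple C B A"
proof -
  have "2 \<le> d c a" if "a \<in> A" "c \<in> C" for a c
  proof -
    have "d c a = d a c"
      using that assms dist_sym clique_verts unfolding clique_triple_def by blast
    with that assms show ?thesis unfolding clique_triple_def by simp
  qed
  with assms show ?thesis unfolding clique_triple_def by blast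
qed

lemma clique_triple_if_clique_path:
  assumes "clique_path V E [A, B, C]"
  shows "clique_triple A B C"
proof -
  note path = assms[unfolded L_clique_path_def]
  have cl: "clique V E A" "clique V E B" "clique V E C" using path by auto
  have trans: "transverse_dist E ([A, B, C] ! i) ([A, B, C] ! j) ((j - i) * 1)"
    if "i < j" "j < 3" for i j
    using path that by simp
  have AB: "transverse_dist E A B 1" using trans[of 0 1] by simp
  have BC: "transverse_dist E B C 1" using trans[of 1 2] by simp
  have AC: "transverse_dist E A C 2" using trans[of 0 2] by simp
  have BA: "transverse_dist E B A 1"
    using transverse_dist_sym AB cl unfolding clique_def by blast
  have "1 \<le> (1::nat) \<and> 1 + 1 < length [A, B, C]" by simp
  with path have
    "\<forall>\<tau>. clique V E \<tau> \<and> transverse_dist E \<tau> ([A, B, C] ! (1 + 1)) 1 \<and>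
         transverse_dist E \<tau> ([A, B, C] ! (1 - 1)) 1 \<and> [A, B, C] ! 1 \<subseteq> \<tau> \<longrightarrow> \<tau> = [A, B, C] ! 1"
    by blast
  then have "\<forall>\<tau>. clique V E \<tau> \<and> transverse_dist E \<tau> C 1 \<and> transverse_dist E \<tau> A 1 \<and> B \<subseteq> \<tau>
      \<longrightarrow> \<tau> = B"
    by simp
  moreover have "\<forall>a\<in>A. \<forall>c\<in>C. 2 \<le> d a c" using AC unfolding transverse_dist_def by blast
  ultimately show ?thesis using cl BA BC unfolding clique_triple_def by blast
qed

text \<open>
  Distance \<open>1\<close> from the far clique \<open>C\<close> at some \<open>c\<close> forces the new vertex out of \<open>A\<close>, because
  \<open>A\<close> and \<open>C\<close> are at distance \<open>2\<close>; so enlarging \<open>B\<close> keeps it transverse to \<open>A\<close>.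
\<close>

lemma transverse_dist_insert:
  assumes T: "clique_triple A B C"
    and a: "a \<in> A" "\<forall>b\<in>B. d b a \<le> 1" and c: "c \<in> C"
    and v: "v \<in> V" "d v a \<le> 1" "d v c \<le> 1"
  shows "transverse_dist E (insert v B) A 1"
proof -
  have cl: "clique V E A" and AC: "\<And>x y. x \<in> A \<Longrightarrow> y \<in> C \<Longrightarrow> 2 \<le> d x y"
    and BA: "transverse_dist E B A 1"
    using T unfolding clique_triple_def by auto
  have "1 \<le> d v y" if "y \<in> A" for y
  proof (rule ccontr)
    assume "\<not> 1 \<le> d v y"
    then have "v = y" using dist_eq_0 v(1) clique_verts[OF cl that] by simp
    then show False using AC[OF that c] v(3) by simp
  qed
  then have low: "\<forall>x\<in>insert v B. \<forall>y\<in>A. 1 \<le> d x y"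
    using BA unfolding transverse_dist_def by blast
  moreover have "\<exists>x\<in>insert v B. \<forall>y\<in>A. d x y = 1"
    using BA unfolding transverse_dist_def by blast
  moreover have "\<forall>x\<in>insert v B. d x a = 1"
    using low a v(2) by (metis insert_iff le_antisym)
  ultimately show ?thesis using a(1) unfolding transverse_dist_def by blast
qed

lemma mem_middle_if_close:
  assumes T: "clique_triple A B C"
    and a: "a \<in> A" "\<forall>b\<in>B. d b a \<le> 1" and c: "c \<in> C" "\<forall>b\<in>B. d b c \<le> 1"
    and v: "v \<in> V" "d v a \<le> 1" "d v c \<le> 1" "\<forall>b\<in>B. d v b \<le> 1"
  shows "v \<in> B"
proof -
  have B: "clique V E B" using T unfolding clique_triple_def by blast
  have edge: "(v, b) \<in> E \<and> (b, v) \<in> E" if "b \<in> B" "v \<noteq> b" for b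
    using edge_if_dist_le_1[of v b] sym_edges v that clique_verts[OF B] by (meson symD)
  have "clique V E (insert v B)"
    using B edge v(1) unfolding clique_def by auto
  moreover have "transverse_dist E (insert v B) A 1"
    by (rule transverse_dist_insert[OF T a c(1) v(1-3)])
  moreover have "transverse_dist E (insert v B) C 1"
    by (rule transverse_dist_insert[OF clique_triple_rev[OF T] c a(1) v(1) v(3) v(2)])
  ultimately have "insert v B = B" using T unfolding clique_triple_def by blast
  then show ?thesis by blast
qed

lemma outer_dominates_middle:
  assumes T: "clique_triple A B C"
  obtains a where "a \<in> A" "\<forall>b\<in>B. d b a \<le> 1"
proof -
  have "transverse_dist E B A 1" using T unfolding clique_triple_def by blast
  then obtain a where "a \<in> A" "\<forall>b\<in>B. d b a = 1" unfolding transverse_dist_def by blast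
  then show ?thesis using that by simp
qed

lemma middle_dominates_outer:
  assumes T: "clique_triple A B C"
  obtains b where "b \<in> B" "\<forall>a\<in>A. d b a \<le> 1"
proof -
  have "transverse_dist E B A 1" using T unfolding clique_triple_def by blast
  then obtain b where "b \<in> B" "\<forall>a\<in>A. d b a = 1" unfolding transverse_dist_def by blast
  then show ?thesis using that by simp
qed

end

section \<open>Helly points in the middle clique\<close>

context helly_graph
begin

lemma helly_points:
  assumes centres: "\<And>x r. (x, r) \<in> F \<Longrightarrow> x \<in> V"
    and meet: "\<And>x r y s. (x, r) \<in> F \<Longrightarrow> (y, s) \<in> F \<Longrightarrow> d x y \<le> r + s"
  obtains v where "v \<in> V" "\<And>x r. (x, r) \<in> F \<Longrightarrow> d x v \<le> r"
proof -
  let ?\<B> = "{graph_ball V E x r | x r. (x, r) \<in> F}"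
  have "?\<B> \<subseteq> {graph_ball V E x r | x r. x \<in> V}" using centres by auto
  moreover have "P \<inter> Q \<noteq> {}" if PQ: "P \<in> ?\<B>" "Q \<in> ?\<B>" for P Q
  proof -
    obtain x r y s where "(x, r) \<in> F" "P = graph_ball V E x r"
      and "(y, s) \<in> F" "Q = graph_ball V E y s"
      using PQ by blast
    then show ?thesis using balls_meet[OF centres centres meet] by simp
  qed
  ultimately have "V \<inter> \<Inter>?\<B> \<noteq> {}" by (rule helly)
  then obtain v where v: "v \<in> V" "v \<in> \<Inter>?\<B>" by blast
  have "d x v \<le> r" if "(x, r) \<in> F" for x r
  proof -
    have "graph_ball V E x r \<in> ?\<B>" using that by blast
    with v(2) have "v \<in> graph_ball V E x r" by blast
    then show ?thesis by (simp add: graph_ball_def)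
  qed
  then show ?thesis using that v(1) by blast
qed

text \<open>
  The set \<open>S\<close> is the part of \<open>A\<close> that the new point is asked to stay close to. The argument needs
  one element of \<open>S\<close> adjacent to all of \<open>B\<close>, so that maximality of \<open>B\<close> applies. Both extremes are
  used: a single such vertex, which asks least of \<open>p\<close>, and all of \<open>A\<close>.
\<close>

lemma helly_point_in_middle:
  assumes T: "clique_triple A B C"
    and S: "S \<subseteq> A" and a: "a \<in> S" "\<forall>b\<in>B. d b a \<le> 1"
    and c: "c \<in> C" "\<forall>b\<in>B. d b c \<le> 1"
    and p: "p \<in> V" "\<forall>s\<in>S. d p s \<le> k + 1" "\<forall>b\<in>B. d p b \<le> k + 1" "d p c \<le> k + 1"
  obtains v where "v \<in> B" "d p v \<le> k" "\<forall>s\<in>S. d v s \<le> 1"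
proof -
  have A: "clique V E A" and B: "clique V E B" and C: "clique V E C"
    using T unfolding clique_triple_def by auto
  have inV: "\<And>s. s \<in> S \<Longrightarrow> s \<in> V" "\<And>b. b \<in> B \<Longrightarrow> b \<in> V" "c \<in> V"
    using A B C S c(1) clique_verts by blast+
  obtain b0 where b0: "b0 \<in> B" "\<forall>s\<in>S. d b0 s \<le> 1"
    using middle_dominates_outer[OF T] S by (metis subsetD)
  have ss: "d s s' \<le> 2" if "s \<in> S" "s' \<in> S" for s s'
    using clique_dist_le_1[OF A, of s s'] S that by fastforce
  have bb: "d b b' \<le> 2" if "b \<in> B" "b' \<in> B" for b b'
    using clique_dist_le_1[OF B, of b b'] that by fastforce
  \<comment> \<open>Elements of \<open>S\<close> reach all of \<open>B\<close> and \<open>c\<close> in two steps through \<open>b0\<close>.\<close>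
  have bs: "d b s \<le> 2" if "b \<in> B" "s \<in> S" for b s
    using dist_triangle[of b b0 s] clique_dist_le_1[OF B, of b b0] b0 inV that by fastforce
  have cs: "d c s \<le> 2" if "s \<in> S" for s
    using dist_triangle[of c b0 s] dist_sym[of c b0] c(2) b0 inV that by fastforce
  have bc: "d b c \<le> 2" if "b \<in> B" for b
    using c(2) that by fastforce
  define F where "F = insert (p, k) ((\<lambda>x. (x, 1)) ` (insert c (S \<union> B)))"
  have FV: "x \<in> V" if "(x, r) \<in> F" for x r
    using that inV p(1) unfolding F_def by auto
  have unit: "d x y \<le> 2" if "x \<in> insert c (S \<union> B)" "y \<in> insert c (S \<union> B)" for x y
  proof -
    have "x \<in> V" "y \<in> V" using that inV by auto
    then have "d x y = d y x" by (rule dist_sym)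
    moreover have "d x y \<le> 2 \<or> d y x \<le> 2"
      using that ss bb bs cs bc by auto
    ultimately show ?thesis by auto
  qed
  have p_unit: "d p x \<le> k + 1" if "x \<in> insert c (S \<union> B)" for x
    using that p by auto
  have unit_p: "d x p \<le> k + 1" if "x \<in> insert c (S \<union> B)" for x
    using p_unit[OF that] dist_sym[of x p] p(1) inV that by auto
  have meet: "d x y \<le> r + s" if "(x, r) \<in> F" "(y, s) \<in> F" for x r y s
    using that unit[of x y] p_unit[of y] unit_p[of x] unfolding F_def by auto
  obtain v where v: "v \<in> V" "\<And>x r. (x, r) \<in> F \<Longrightarrow> d x v \<le> r"
    by (rule helly_points[of F]) (use FV meet in blast)+
  have pv: "d p v \<le> k" by (rule v(2)) (simp add: F_def)
  have near: "d v x \<le> 1" if "x \<in> insert c (S \<union> B)" for x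
  proof -
    have "(x, 1) \<in> F" using that by (auto simp: F_def)
    then have "d x v \<le> 1" "x \<in> V" using v(2) FV by blast+
    then show ?thesis using dist_sym[of x v] v(1) by simp
  qed
  have "v \<in> B"
    using mem_middle_if_close[OF T _ a(2) c v(1)] S a(1) near by blast
  then show ?thesis using that pv near by blast
qed

text \<open>
  The vertex \<open>q\<close> witnesses that \<open>p\<close> is near \<open>B\<close>, hence within one more step of all of \<open>B\<close> and of
  any vertex of \<open>C\<close> adjacent to all of \<open>B\<close>. This is how the clique \<open>C\<close> on the other side of \<open>B\<close>
  helps to find a vertex of \<open>B\<close> that is as near to \<open>p\<close> and adjacent to all of \<open>A\<close>.
\<close>

lemma move_towards_neighbour:
  assumes T: "clique_triple A B C"
    and p: "p \<in> V" "\<forall>a\<in>A. d p a \<le> k + 1" and q: "q \<in> B" "d p q \<le> k"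
  obtains z where "z \<in> B" "d p z \<le> k" "\<forall>a\<in>A. d z a \<le> 1"
proof -
  have B: "clique V E B" and C: "clique V E C"
    using T unfolding clique_triple_def by auto
  obtain a where a: "a \<in> A" "\<forall>b\<in>B. d b a \<le> 1" by (rule outer_dominates_middle[OF T])
  obtain c where c: "c \<in> C" "\<forall>b\<in>B. d b c \<le> 1"
    by (rule outer_dominates_middle[OF clique_triple_rev[OF T]])
  have via_q: "d p x \<le> k + 1" if "x \<in> V" "d q x \<le> 1" for x
    using dist_triangle[of p q x] p(1) q clique_verts[OF B] that by fastforce
  have "\<forall>b\<in>B. d p b \<le> k + 1"
    using via_q clique_verts[OF B] clique_dist_le_1[OF B q(1)] by blast
  moreover have "d p c \<le> k + 1"
    using via_q clique_verts[OF C] c q(1) by blast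
  ultimately show ?thesis
    by (rule helly_point_in_middle[OF T subset_refl a c p]) (rule that)
qed

end

section \<open>Bi-infinite local clique-paths\<close>

locale local_clique_path = helly_graph V E for V :: "'a set" and E +
  fixes \<sigma> :: "int \<Rightarrow> 'a set"
  assumes triple: "\<And>n. clique_triple (\<sigma> (n - 1)) (\<sigma> n) (\<sigma> (n + 1))"
begin

lemma cliques: "clique V E (\<sigma> n)"
  using triple[of n] unfolding clique_triple_def by blast

lemma in_V: "x \<in> \<sigma> n \<Longrightarrow> x \<in> V"
  by (rule clique_verts[OF cliques])

lemma dist_next: "x \<in> \<sigma> n \<Longrightarrow> y \<in> \<sigma> (n + 1) \<Longrightarrow> 1 \<le> d x y"
proof -
  have "transverse_dist E (\<sigma> n) (\<sigma> (n + 1)) 1"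
    using triple[of n] unfolding clique_triple_def by blast
  then show "x \<in> \<sigma> n \<Longrightarrow> y \<in> \<sigma> (n + 1) \<Longrightarrow> 1 \<le> d x y"
    unfolding transverse_dist_def by blast
qed

lemma dist_next2: "x \<in> \<sigma> n \<Longrightarrow> y \<in> \<sigma> (n + 2) \<Longrightarrow> 2 \<le> d x y"
proof -
  have "clique_triple (\<sigma> n) (\<sigma> (n + 1)) (\<sigma> (n + 2))"
    using triple[of "n + 1"] by (simp add: add.commute)
  then show "x \<in> \<sigma> n \<Longrightarrow> y \<in> \<sigma> (n + 2) \<Longrightarrow> 2 \<le> d x y"
    unfolding clique_triple_def by blast
qed

text \<open>
  In each later clique there is a vertex adjacent to all of the following clique; these vertices
  form a path that starts at \<open>x\<close>.
\<close>

lemma dist_le_forwards: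
  assumes x: "x \<in> \<sigma> i" "\<forall>y\<in>\<sigma> (i + 1). d x y \<le> 1"
    and n: "1 \<le> n" and y: "y \<in> \<sigma> (i + int n)"
  shows "d x y \<le> n"
  using n y
proof (induction n arbitrary: y rule: dec_induct)
  case base
  then show ?case using x(2) by simp
next
  case (step n)
  obtain b where b: "b \<in> \<sigma> (i + int n)" "\<forall>a\<in>\<sigma> (i + int n + 1). d b a \<le> 1"
    by (rule middle_dominates_outer[OF clique_triple_rev[OF triple]])
  have y: "y \<in> \<sigma> (i + int n + 1)" using step.prems by (simp add: algebra_simps)
  have "d x y \<le> d x b + d b y"
    using dist_triangle[of x b y] in_V x(1) b(1) y by blast
  also have "\<dots> \<le> n + 1" using step.IH[OF b(1)] b(2)[rule_format, OF y] by linarith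
  finally show ?case by simp
qed

lemma dist_le_backwards:
  assumes z: "z \<in> \<sigma> j" "\<forall>y\<in>\<sigma> (j - 1). d z y \<le> 1"
    and n: "1 \<le> n" and y: "y \<in> \<sigma> (j - int n)"
  shows "d z y \<le> n"
  using n y
proof (induction n arbitrary: y rule: dec_induct)
  case base
  then show ?case using z(2) by simp
next
  case (step n)
  obtain b where b: "b \<in> \<sigma> (j - int n)" "\<forall>a\<in>\<sigma> (j - int n - 1). d b a \<le> 1"
    by (rule middle_dominates_outer[OF triple])
  have y: "y \<in> \<sigma> (j - int n - 1)" using step.prems by (simp add: algebra_simps)
  have "d z y \<le> d z b + d b y"
    using dist_triangle[of z b y] in_V z(1) b(1) y by blast
  also have "\<dots> \<le> n + 1" using step.IH[OF b(1)] b(2)[rule_format, OF y] by linarith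
  finally show ?case by simp
qed

lemma dist_le_Suc:
  assumes p: "p \<in> \<sigma> i" and n: "1 \<le> n" and y: "y \<in> \<sigma> (i + int n)"
  shows "d p y \<le> n + 1"
proof -
  obtain x where x: "x \<in> \<sigma> i" "\<forall>y\<in>\<sigma> (i + 1). d x y \<le> 1"
    by (rule middle_dominates_outer[OF clique_triple_rev[OF triple]])
  have "d p y \<le> d p x + d x y"
    using dist_triangle[of p x y] in_V p x(1) y by blast
  then show ?thesis
    using dist_le_forwards[OF x n y] clique_dist_le_1[OF cliques p x(1)] by linarith
qed

text \<open>
  All of \<open>\<sigma> (i + m)\<close> is at distance exactly \<open>m\<close> from \<open>x\<close>, and \<open>\<sigma> (i + m - 1)\<close> is no further
  away. If \<open>z\<close>, on the other side, were also within \<open>m\<close> of \<open>x\<close>, then a Helly point in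
  \<open>\<sigma> (i + m)\<close> would be at distance at most \<open>m - 1\<close> from \<open>x\<close>.
\<close>

lemma dist_dominating_ends:
  assumes m: "2 \<le> m"
    and IH: "\<And>y. y \<in> \<sigma> (i + int m) \<Longrightarrow> m \<le> d x y"
    and x: "x \<in> \<sigma> i" "\<forall>y\<in>\<sigma> (i + 1). d x y \<le> 1"
    and z: "z \<in> \<sigma> (i + int m + 1)" "\<forall>y\<in>\<sigma> (i + int m). d z y \<le> 1"
  shows "m + 1 \<le> d x z"
proof (rule ccontr)
  assume "\<not> m + 1 \<le> d x z"
  moreover define k where "k = m - 1"
  ultimately have xz: "d x z \<le> k + 1" and km: "m = k + 1" "1 \<le> k" using m by auto
  let ?j = "i + int m"
  have T: "clique_triple (\<sigma> (?j - 1)) (\<sigma> ?j) (\<sigma> (?j + 1))" by (rule triple)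
  obtain a where a: "a \<in> \<sigma> (?j - 1)" "\<forall>b\<in>\<sigma> ?j. d b a \<le> 1"
    by (rule outer_dominates_middle[OF T])
  have "d x a \<le> k"
    by (rule dist_le_forwards[OF x km(2)]) (use a(1) km(1) in simp)
  then have xa: "\<forall>s\<in>{a}. d x s \<le> k + 1" by simp
  have xb: "\<forall>b\<in>\<sigma> ?j. d x b \<le> k + 1"
    using dist_le_forwards[OF x, of m] m km(1) by simp
  have zb: "\<forall>b\<in>\<sigma> ?j. d b z \<le> 1"
    using z(2) dist_sym[OF in_V[OF z(1)] in_V] by fastforce
  have a': "{a} \<subseteq> \<sigma> (?j - 1)" "a \<in> {a}" using a(1) by auto
  obtain v where "v \<in> \<sigma> ?j" "d x v \<le> k"
    using helly_point_in_middle[OF T a' a(2) z(1) zb in_V[OF x(1)] xa xb xz] by blast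
  with IH[of v] km(1) show False by simp
qed

theorem dist_ge: "p \<in> \<sigma> i \<Longrightarrow> q \<in> \<sigma> (i + int n) \<Longrightarrow> n \<le> d p q"
proof (induction n arbitrary: i p q)
  case 0
  then show ?case by simp
next
  case (Suc m)
  consider "m = 0" | "m = 1" | "2 \<le> m" by linarith
  then show ?case
  proof cases
    case 1
    then show ?thesis using dist_next Suc.prems by simp
  next
    case 2
    then show ?thesis using dist_next2[of p i q] Suc.prems by simp
  next
    case 3
    show ?thesis
    proof (rule ccontr)
      assume "\<not> Suc m \<le> d p q"
      then have pq: "d p q \<le> m" by simp
      let ?j = "i + int m + 1"
      have q: "q \<in> \<sigma> ?j" using Suc.prems(2) by (simp add: algebra_simps)
      have T: "clique_triple (\<sigma> (i + int m)) (\<sigma> ?j) (\<sigma> (?j + 1))"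
        using triple[of ?j] by simp
      have "\<forall>a\<in>\<sigma> (i + int m). d p a \<le> m + 1"
        using dist_le_Suc[OF Suc.prems(1)] 3 by simp
      then obtain z where z: "z \<in> \<sigma> ?j" "d p z \<le> m" "\<forall>a\<in>\<sigma> (i + int m). d z a \<le> 1"
        using move_towards_neighbour[OF T in_V[OF Suc.prems(1)] _ q pq] by blast
      have zp: "d z p \<le> m"
        using z(2) dist_sym[OF in_V[OF z(1)] in_V[OF Suc.prems(1)]] by simp
      \<comment> \<open>The same step at the other end, with the triple read backwards.\<close>
      have T': "clique_triple (\<sigma> (i + 1)) (\<sigma> i) (\<sigma> (i - 1))"
        by (rule clique_triple_rev[OF triple])
      have "d z a \<le> m + 1" if "a \<in> \<sigma> (i + 1)" for a
        using dist_le_backwards[OF z(1), of m a] z(3) 3 that by (simp add: algebra_simps)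
      then obtain x where x: "x \<in> \<sigma> i" "d z x \<le> m" "\<forall>a\<in>\<sigma> (i + 1). d x a \<le> 1"
        using move_towards_neighbour[OF T' in_V[OF z(1)] _ Suc.prems(1) zp] by blast
      have "m + 1 \<le> d x z"
        by (rule dist_dominating_ends[OF 3 Suc.IH[OF x(1)] x(1,3) z(1,3)])
      moreover have "d x z = d z x" using dist_sym in_V x(1) z(1) by blast
      ultimately show False using x(2) by simp
    qed
  qed
qed

lemma clique_dist_ge: "\<bar>n - m\<bar> \<le> int (clique_dist E (\<sigma> n) (\<sigma> m))"
proof -
  let ?D = "{d x y | x y. x \<in> \<sigma> n \<and> y \<in> \<sigma> m}"
  have "?D \<noteq> {}" using cliques[of n] cliques[of m] unfolding clique_def by blast
  then have "Inf ?D \<in> ?D" by (rule Inf_nat_def1)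
  then obtain x y where xy: "x \<in> \<sigma> n" "y \<in> \<sigma> m" "clique_dist E (\<sigma> n) (\<sigma> m) = d x y"
    unfolding clique_dist_def by auto
  show ?thesis
  proof (cases "n \<le> m")
    case True
    then show ?thesis using dist_ge[of x n y "nat (m - n)"] xy by simp
  next
    case False
    then have "nat (n - m) \<le> d y x" using dist_ge[of y m x "nat (n - m)"] xy by simp
    then show ?thesis using False xy(3) dist_sym[OF in_V[OF xy(1)] in_V[OF xy(2)]] by simp
  qed
qed

end

theorem theoremK:
  fixes V :: "'a set" and E :: "('a \<times> 'a) set" and \<sigma> :: "int \<Rightarrow> 'a set"
  assumes "helly_graph V E"
    and "\<And>n. clique V E (\<sigma> n)"
    and "\<And>n. clique_path V E [\<sigma> n, \<sigma> (n + 1), \<sigma> (n + 2)]"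
  shows "\<And>n m. \<bar>n - m\<bar> \<le> int (clique_dist E (\<sigma> n) (\<sigma> m))"
proof -
  interpret helly_graph V E by (rule assms(1))
  interpret local_clique_path V E \<sigma>
  proof
    show "clique_triple (\<sigma> (n - 1)) (\<sigma> n) (\<sigma> (n + 1))" for n
      using clique_triple_if_clique_path[OF assms(3)[of "n - 1"]] by (simp add: algebra_simps)
  qed
  show "\<bar>n - m\<bar> \<le> int (clique_dist E (\<sigma> n) (\<sigma> m))" for n m
    by (rule clique_dist_ge)
qed

end
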